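(* Let $X$ be a set with a distance $\mathbf{d}$, and let $Q$ be a compact topological space. Let $f:Q\to X$ be continuous with respect to the topology $X_\bullet$ on $X$, and let $(g_\lambda)$ be a net of functions $Q\to X$, each continuous with respect to the topology $X^\bullet$ on $X$, such that $(g_\lambda)$ is $\sup\text{-}\mathbf{d}$-Cauchy. Then (the limits existing in $[0,\infty]$) \[\lim_\lambda\sup_{p\in Q}\mathbf{d}(f(p),g_\lambda(p))=\sup_{p\in Q}\lim_\lambda\mathbf{d}(f(p),g_\lambda(p)).\]
   Context: A distance on a set $X$ is a function $\mathbf{d}:X\times X\to[0,\infty]$ satisfying the triangle inequality $\mathbf{d}(x,y)\leq\mathbf{d}(x,z)+\mathbf{d}(z,y)$ for all $x,y,z\in X$ (no symmetry, and $\mathbf{d}(x,x)=0$ is not required). $X^\bullet$ is the topology on $X$ generated (by arbitrary unions of finite intersections) by the upper balls $\{x\in X:\mathbf{d}(c,x)<\epsilon\}$, and $X_\bullet$ is the topology on $X$ generated by the lower balls $\{x\in X:\mathbf{d}(x,c)<\epsilon\}$, for $c\in X$ and $\epsilon>0$. A net is a family indexed by a (nonempty) set $\Lambda$ with a transitive, possibly non-reflexive, relation $\prec$ such that for all $\gamma,\delta\in\Lambda$ there is $\lambda\in\Lambda$ with $\gamma,\delta\prec\lambda$. The limit inferior and limit superior of a net in $[0,\infty]$ are $\liminf_\lambda r_\lambda=\lim_\gamma\inf_{\gamma\prec\lambda}r_\lambda$ and $\limsup_\lambda r_\lambda=\lim_\gamma\sup_{\gamma\prec\lambda}r_\lambda$,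 and $\lim_\lambda r_\lambda$ is their common value when they agree. For a distance $\mathbf{e}$ on a set $Z$, a net $(z_\lambda)\subseteq Z$ is $\mathbf{e}$-Cauchy if $\lim_\gamma\sup_{\gamma\prec\delta}\mathbf{e}(z_\gamma,z_\delta)=0$. On $X^Q$ the supremum distance is $\sup\text{-}\mathbf{d}(f,g)=\sup_{p\in Q}\mathbf{d}(f(p),g(p))$. Suprema are taken in $[0,\infty]$. *)

theory Defs
  imports "HOL-Analysis.Analysis"
begin

section \<open>Distances and their upper and lower ball topologies\<close>

definition is_distance :: "'a set \<Rightarrow> ('a \<Rightarrow> 'a \<Rightarrow> ennreal) \<Rightarrow> bool" where
  "is_distance X d \<longleftrightarrow> (\<forall>x\<in>X. \<forall>y\<in>X. \<forall>z\<in>X. d x y \<le> d x z + d z y)"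

text \<open>
  As \<open>d x x = 0\<close> is not required, the balls need not cover \<open>X\<close>. The set \<open>X\<close>, the
  intersection of the empty family, is therefore added to the generating sets explicitly.
  The radius \<open>\<epsilon> = \<infinity>\<close> is allowed but redundant: such a ball is the union of the balls of finite
  radius around the same centre.
\<close>

definition upper_ball_topology :: "'a set \<Rightarrow> ('a \<Rightarrow> 'a \<Rightarrow> ennreal) \<Rightarrow> 'a topology" where
  "upper_ball_topology X d =
     topology_generated_by (insert X {{x \<in> X. d c x < \<epsilon>} | c \<epsilon>. c \<in> X \<and> \<epsilon> > 0})"

definition lower_ball_topology :: "'a set \<Rightarrow> ('a \<Rightarrow> 'a \<Rightarrow> ennreal) \<Rightarrow> 'a topology" where
  "lower_ball_topology X d =
     topology_generated_by (insert X {{x \<in> X. d x c < \<epsilon>} | c \<epsilon>. c \<in> X \<and> \<epsilon> > 0})"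

lemma topspace_upper_ball_topology [simp]: "topspace (upper_ball_topology X d) = X"
  unfolding upper_ball_topology_def topology_generated_by_topspace by auto

lemma topspace_lower_ball_topology [simp]: "topspace (lower_ball_topology X d) = X"
  unfolding lower_ball_topology_def topology_generated_by_topspace by auto

definition sup_dist :: "'q set \<Rightarrow> ('a \<Rightarrow> 'a \<Rightarrow> ennreal) \<Rightarrow> ('q \<Rightarrow> 'a) \<Rightarrow> ('q \<Rightarrow> 'a) \<Rightarrow> ennreal" where
  "sup_dist Q d f g = (SUP p\<in>Q. d (f p) (g p))"

section \<open>Nets\<close>

definition is_net :: "'i set \<Rightarrow> ('i \<Rightarrow> 'i \<Rightarrow> bool) \<Rightarrow> bool" where
  "is_net I R \<longleftrightarrow> I \<noteq> {} \<and> transp_on I R \<and> (\<forall>i\<in>I. \<forall>j\<in>I. \<exists>k\<in>I. R i k \<and> R j k)"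

definition net_tail :: "'i set \<Rightarrow> ('i \<Rightarrow> 'i \<Rightarrow> bool) \<Rightarrow> 'i \<Rightarrow> 'i set" where
  "net_tail I R i = {j \<in> I. R i j}"

definition net_filter :: "'i set \<Rightarrow> ('i \<Rightarrow> 'i \<Rightarrow> bool) \<Rightarrow> 'i filter" where
  "net_filter I R = (INF i\<in>I. principal (net_tail I R i))"

text \<open>
  The outer limits below are limits of monotone nets in the usual topology of \<open>[0,\<infinity>]\<close>. They
  always exist and are computed in \<open>net_liminf_eq_SUP_INF\<close> and \<open>net_limsup_eq_INF_SUP\<close>.
\<close>

definition net_liminf :: "'i set \<Rightarrow> ('i \<Rightarrow> 'i \<Rightarrow> bool) \<Rightarrow> ('i \<Rightarrow> ennreal) \<Rightarrow> ennreal" where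
  "net_liminf I R r = Lim (net_filter I R) (\<lambda>i. INF j\<in>net_tail I R i. r j)"

definition net_limsup :: "'i set \<Rightarrow> ('i \<Rightarrow> 'i \<Rightarrow> bool) \<Rightarrow> ('i \<Rightarrow> ennreal) \<Rightarrow> ennreal" where
  "net_limsup I R r = Lim (net_filter I R) (\<lambda>i. SUP j\<in>net_tail I R i. r j)"

definition net_convergent :: "'i set \<Rightarrow> ('i \<Rightarrow> 'i \<Rightarrow> bool) \<Rightarrow> ('i \<Rightarrow> ennreal) \<Rightarrow> bool" where
  "net_convergent I R r \<longleftrightarrow> net_liminf I R r = net_limsup I R r"

text \<open>Only meaningful for convergent nets, where it equals the limit superior as well.\<close>

definition net_lim :: "'i set \<Rightarrow> ('i \<Rightarrow> 'i \<Rightarrow> bool) \<Rightarrow> ('i \<Rightarrow> ennreal) \<Rightarrow> ennreal" where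
  "net_lim I R r = net_liminf I R r"

definition cauchy_net ::
  "'i set \<Rightarrow> ('i \<Rightarrow> 'i \<Rightarrow> bool) \<Rightarrow> ('z \<Rightarrow> 'z \<Rightarrow> ennreal) \<Rightarrow> ('i \<Rightarrow> 'z) \<Rightarrow> bool" where
  "cauchy_net I R e z \<longleftrightarrow>
     net_convergent I R (\<lambda>i. SUP j\<in>net_tail I R i. e (z i) (z j)) \<and>
     net_lim I R (\<lambda>i. SUP j\<in>net_tail I R i. e (z i) (z j)) = 0"

section \<open>Net limits in terms of filters\<close>

lemma eventually_net_filter:
  assumes "is_net I R"
  shows "eventually P (net_filter I R) \<longleftrightarrow> (\<exists>i\<in>I. \<forall>j\<in>net_tail I R i. P j)"
proof -
  have "\<exists>k\<in>I. principal (net_tail I R k) \<le> inf (principal (net_tail I R i)) (principal (net_tail I R j))"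
    if ij: "i \<in> I" "j \<in> I" for i j
  proof -
    obtain k where k: "k \<in> I" "R i k" "R j k"
      using assms ij unfolding is_net_def by blast
    have "transp_on I R" using assms by (simp add: is_net_def)
    then have "net_tail I R k \<subseteq> net_tail I R i \<inter> net_tail I R j"
      using k ij unfolding net_tail_def by (auto dest: transp_onD)
    with k(1) show ?thesis by auto
  qed
  then show ?thesis
    using assms unfolding net_filter_def is_net_def
    by (subst eventually_INF_base) (auto simp: eventually_principal)
qed

lemma net_filter_neq_bot:
  assumes "is_net I R"
  shows "net_filter I R \<noteq> bot"
proof -
  have "net_tail I R i \<noteq> {}" if "i \<in> I" for i
    using assms that unfolding is_net_def net_tail_def by fast
  then show ?thesis
    using eventually_net_filter[OF assms, of "\<lambda>_. False"] by (auto simp: trivial_limit_def)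
qed

lemma net_tail_mono:
  assumes "is_net I R" "i \<in> I" "j \<in> net_tail I R i"
  shows "net_tail I R j \<subseteq> net_tail I R i"
  using assms unfolding is_net_def net_tail_def by (auto dest: transp_onD)

lemma net_liminf_eq_SUP_INF:
  assumes "is_net I R"
  shows "net_liminf I R r = (SUP i\<in>I. INF j\<in>net_tail I R i. r j)"
  unfolding net_liminf_def
proof (rule tendsto_Lim[OF net_filter_neq_bot[OF assms]], rule order_tendstoI)
  let ?h = "\<lambda>i. INF j\<in>net_tail I R i. r j"
  fix a assume "a < (SUP i\<in>I. ?h i)"
  then obtain i where i: "i \<in> I" "a < ?h i" by (auto simp: less_SUP_iff)
  have "a < ?h k" if "k \<in> net_tail I R i" for k
    using i(2) INF_superset_mono[OF net_tail_mono[OF assms i(1) that], of r r]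
    by (auto intro: less_le_trans)
  with i(1) show "\<forall>\<^sub>F k in net_filter I R. a < ?h k"
    by (auto simp: eventually_net_filter[OF assms])
next
  let ?h = "\<lambda>i. INF j\<in>net_tail I R i. r j"
  fix a assume a: "(SUP i\<in>I. ?h i) < a"
  have "?h k < a" if "k \<in> I" for k
    using SUP_upper[OF that, of ?h] a by (rule le_less_trans)
  moreover obtain i where "i \<in> I" using assms by (auto simp: is_net_def)
  ultimately show "\<forall>\<^sub>F k in net_filter I R. ?h k < a"
    by (auto simp: eventually_net_filter[OF assms] net_tail_def)
qed

lemma net_limsup_eq_INF_SUP:
  assumes "is_net I R"
  shows "net_limsup I R r = (INF i\<in>I. SUP j\<in>net_tail I R i. r j)"
  unfolding net_limsup_def
proof (rule tendsto_Lim[OF net_filter_neq_bot[OF assms]], rule order_tendstoI)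
  let ?h = "\<lambda>i. SUP j\<in>net_tail I R i. r j"
  fix a assume "(INF i\<in>I. ?h i) < a"
  then obtain i where i: "i \<in> I" "?h i < a" by (auto simp: INF_less_iff)
  have "?h k < a" if "k \<in> net_tail I R i" for k
    using i(2) SUP_subset_mono[OF net_tail_mono[OF assms i(1) that], of r r]
    by (auto intro: le_less_trans)
  with i(1) show "\<forall>\<^sub>F k in net_filter I R. ?h k < a"
    by (auto simp: eventually_net_filter[OF assms])
next
  let ?h = "\<lambda>i. SUP j\<in>net_tail I R i. r j"
  fix a assume a: "a < (INF i\<in>I. ?h i)"
  have "a < ?h k" if "k \<in> I" for k
    using a INF_lower[OF that, of ?h] by (rule less_le_trans)
  moreover obtain i where "i \<in> I" using assms by (auto simp: is_net_def)
  ultimately show "\<forall>\<^sub>F k in net_filter I R. a < ?h k"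
    by (auto simp: eventually_net_filter[OF assms] net_tail_def)
qed

lemma net_liminf_eq_Liminf:
  assumes "is_net I R"
  shows "net_liminf I R r = Liminf (net_filter I R) r"
  unfolding net_liminf_eq_SUP_INF[OF assms] Liminf_def
proof (rule antisym)
  show "(SUP i\<in>I. INF j\<in>net_tail I R i. r j) \<le> (SUP P\<in>{P. eventually P (net_filter I R)}. Inf (r ` Collect P))"
  proof (rule SUP_mono)
    fix i assume "i \<in> I"
    then show "\<exists>P\<in>{P. eventually P (net_filter I R)}. (INF j\<in>net_tail I R i. r j) \<le> Inf (r ` Collect P)"
      by (intro bexI[of _ "\<lambda>j. j \<in> net_tail I R i"]) (auto simp: eventually_net_filter[OF assms])
  qed
  show "(SUP P\<in>{P. eventually P (net_filter I R)}. Inf (r ` Collect P)) \<le> (SUP i\<in>I. INF j\<in>net_tail I R i. r j)"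
  proof (rule SUP_mono)
    fix P assume "P \<in> {P. eventually P (net_filter I R)}"
    then obtain i where "i \<in> I" "net_tail I R i \<subseteq> Collect P"
      by (auto simp: eventually_net_filter[OF assms])
    then show "\<exists>i\<in>I. Inf (r ` Collect P) \<le> (INF j\<in>net_tail I R i. r j)"
      by (intro bexI[of _ i] INF_superset_mono) auto
  qed
qed

lemma net_limsup_eq_Limsup:
  assumes "is_net I R"
  shows "net_limsup I R r = Limsup (net_filter I R) r"
  unfolding net_limsup_eq_INF_SUP[OF assms] Limsup_def
proof (rule antisym)
  show "(INF P\<in>{P. eventually P (net_filter I R)}. Sup (r ` Collect P)) \<le> (INF i\<in>I. SUP j\<in>net_tail I R i. r j)"
  proof (rule INF_mono)
    fix i assume "i \<in> I"
    then show "\<exists>P\<in>{P. eventually P (net_filter I R)}. Sup (r ` Collect P) \<le> (SUP j\<in>net_tail I R i. r j)"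
      by (intro bexI[of _ "\<lambda>j. j \<in> net_tail I R i"]) (auto simp: eventually_net_filter[OF assms])
  qed
  show "(INF i\<in>I. SUP j\<in>net_tail I R i. r j) \<le> (INF P\<in>{P. eventually P (net_filter I R)}. Sup (r ` Collect P))"
  proof (rule INF_mono)
    fix P assume "P \<in> {P. eventually P (net_filter I R)}"
    then obtain i where "i \<in> I" "net_tail I R i \<subseteq> Collect P"
      by (auto simp: eventually_net_filter[OF assms])
    then show "\<exists>i\<in>I. (SUP j\<in>net_tail I R i. r j) \<le> Sup (r ` Collect P)"
      by (intro bexI[of _ i] SUP_subset_mono) auto
  qed
qed

lemma net_lim_iff_tendsto:
  assumes "is_net I R"
  shows "net_convergent I R r \<and> net_lim I R r = l \<longleftrightarrow> (r \<longlongrightarrow> l) (net_filter I R)"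
  using tendsto_iff_Liminf_eq_Limsup[OF net_filter_neq_bot[OF assms], of r l]
  unfolding net_convergent_def net_lim_def
    net_liminf_eq_Liminf[OF assms] net_limsup_eq_Limsup[OF assms] by metis

end

theory Submission
  imports Defs
begin

text \<open>
  All the distances involved are almost decreasing along the net: if \<open>\<delta>\<close> comes after a late
  enough \<open>\<gamma>\<close>, the triangle inequality through \<open>g \<gamma> p\<close> gives
  \<open>d (f p) (g \<delta> p) \<le> d (f p) (g \<gamma> p) + \<epsilon>\<close>, with the same \<open>\<epsilon>\<close> for every point \<open>p\<close>. Hence all
  the limits exist (\<open>net_convergent_if_almost_decreasing\<close>), and the inequality \<open>\<ge>\<close> is
  monotonicity of limits.

  The inequality \<open>\<le>\<close> is a Dini argument. Let \<open>S\<close> be the supremum of the pointwise limits.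
  Near every point \<open>p\<close> some late member of the net is at most slightly more than \<open>S\<close> away from
  \<open>f\<close>; almost decrease carries this over to all later members, and compactness of \<open>Q\<close>
  makes it uniform. The delicate point is the bound near \<open>p\<close>. Comparing \<open>f q\<close> with \<open>g \<gamma> q\<close> for a
  single \<open>\<gamma>\<close> would have to pass through \<open>f p\<close> or \<open>g \<gamma> p\<close>, and self-distances
  need not vanish. Two indices avoid this: the path runs from \<open>f q\<close> to \<open>g \<gamma> p\<close> to \<open>g \<delta> q\<close> with
  \<open>\<delta>\<close> after \<open>\<gamma>\<close>. The first step is controlled by continuity of \<open>f\<close> for lower balls, the second
  by the Cauchy condition together with continuity of \<open>g \<delta>\<close> for upper balls
  (\<open>eventually_close_near_point\<close>).
\<close>

lemma eventually_mem_net_tail: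
  assumes "is_net I R" "i \<in> I"
  shows "\<forall>\<^sub>F j in net_filter I R. j \<in> net_tail I R i"
  using assms by (auto simp: eventually_net_filter)

lemma eventually_mem_net:
  assumes "is_net I R"
  shows "\<forall>\<^sub>F i in net_filter I R. i \<in> I"
  using assms by (auto simp: eventually_net_filter net_tail_def is_net_def)

lemma cauchy_net_eventually_less:
  assumes "is_net I R" "cauchy_net I R e z" "0 < \<epsilon>"
  shows "\<forall>\<^sub>F i in net_filter I R. \<forall>j\<in>net_tail I R i. e (z i) (z j) < \<epsilon>"
proof -
  have "((\<lambda>i. SUP j\<in>net_tail I R i. e (z i) (z j)) \<longlongrightarrow> 0) (net_filter I R)"
    using assms net_lim_iff_tendsto unfolding cauchy_net_def by blast
  then have "\<forall>\<^sub>F i in net_filter I R. (SUP j\<in>net_tail I R i. e (z i) (z j)) < \<epsilon>"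
    using \<open>0 < \<epsilon>\<close> by (rule order_tendstoD)
  then show ?thesis
    by (rule eventually_mono) (intro ballI, rule SUP_lessD)
qed

text \<open>
  Any late value of the net bounds the limit superior up to \<open>\<epsilon>\<close>, and arbitrarily late values
  come close to the limit inferior.
\<close>

lemma net_convergent_if_almost_decreasing:
  fixes r :: "'i \<Rightarrow> ennreal"
  assumes net: "is_net I R"
    and decr: "\<And>\<epsilon>. 0 < \<epsilon> \<Longrightarrow>
      \<forall>\<^sub>F i in net_filter I R. \<forall>j\<in>net_tail I R i. r j \<le> r i + \<epsilon>"
  shows "net_convergent I R r"
proof -
  let ?F = "net_filter I R"
  have "Limsup ?F r \<le> Liminf ?F r"
  proof (rule ennreal_le_epsilon)
    fix e :: real assume fin: "Liminf ?F r < top" and "0 < e"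
    define \<eta> where "\<eta> = ennreal (e / 2)"
    have \<eta>: "0 < \<eta>" "\<eta> + \<eta> = ennreal e"
      using \<open>0 < e\<close> by (auto simp: \<eta>_def simp flip: ennreal_plus)
    have "\<not> Liminf ?F r + \<eta> \<le> Liminf ?F r"
      using fin \<eta>(1) ennreal_add_left_cancel_less[of "Liminf ?F r" 0 \<eta>] by (auto simp: not_le)
    then have "\<not> (\<forall>\<^sub>F i in ?F. Liminf ?F r + \<eta> \<le> r i)"
      using Liminf_bounded by blast
    then have "\<exists>\<^sub>F i in ?F. r i < Liminf ?F r + \<eta>"
      by (simp add: frequently_def not_less)
    then have "\<exists>\<^sub>F i in ?F. r i < Liminf ?F r + \<eta> \<and> i \<in> I \<and> (\<forall>j\<in>net_tail I R i. r j \<le> r i + \<eta>)"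
      using eventually_conj[OF eventually_mem_net[OF net] decr[OF \<eta>(1)]]
      by (rule frequently_eventually_frequently)
    then obtain i where i: "i \<in> I" "r i < Liminf ?F r + \<eta>"
        "\<forall>j\<in>net_tail I R i. r j \<le> r i + \<eta>"
      by (blast dest: frequently_ex)
    have "\<forall>\<^sub>F j in ?F. r j \<le> Liminf ?F r + \<eta> + \<eta>"
      using eventually_mem_net_tail[OF net i(1)]
    proof (rule eventually_mono)
      fix j assume "j \<in> net_tail I R i"
      then have "r j \<le> r i + \<eta>" using i(3) by blast
      also have "\<dots> \<le> Liminf ?F r + \<eta> + \<eta>"
        using i(2) by (intro add_right_mono less_imp_le)
      finally show "r j \<le> Liminf ?F r + \<eta> + \<eta>" .
    qed
    then show "Limsup ?F r \<le> Liminf ?F r + ennreal e"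
      unfolding \<eta>(2)[symmetric] add.assoc by (rule Limsup_bounded)
  qed
  moreover have "Liminf ?F r \<le> Limsup ?F r"
    using net_filter_neq_bot[OF net] by (rule Liminf_le_Limsup)
  ultimately show ?thesis
    using net by (simp add: net_convergent_def net_liminf_eq_Liminf net_limsup_eq_Limsup)
qed

lemma compact_space_eventually_ball:
  assumes "compact_space Q"
    and local: "\<And>p. p \<in> topspace Q \<Longrightarrow>
      \<exists>U. openin Q U \<and> p \<in> U \<and> (\<forall>\<^sub>F i in F. \<forall>q\<in>U. P i q)"
  shows "\<forall>\<^sub>F i in F. \<forall>q\<in>topspace Q. P i q"
proof -
  define \<U> where "\<U> = {U. openin Q U \<and> (\<forall>\<^sub>F i in F. \<forall>q\<in>U. P i q)}"
  have "topspace Q \<subseteq> \<Union>\<U>" "\<forall>U\<in>\<U>. openin Q U"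
    using local by (auto simp: \<U>_def)
  then obtain \<V> where \<V>: "finite \<V>" "\<V> \<subseteq> \<U>" "topspace Q \<subseteq> \<Union>\<V>"
    using assms(1) unfolding compact_space_alt by metis
  have "\<forall>\<^sub>F i in F. \<forall>U\<in>\<V>. \<forall>q\<in>U. P i q"
    using \<V> by (intro eventually_ball_finite) (auto simp: \<U>_def)
  then show ?thesis
    by (rule eventually_mono) (use \<V>(3) in blast)
qed

lemma openin_preimage_lower_ball:
  assumes "continuous_map Q (lower_ball_topology X d) f" "c \<in> X"
  shows "openin Q {q \<in> topspace Q. d (f q) c < \<epsilon>}"
proof (cases "\<epsilon> > 0")
  case True
  then have "openin (lower_ball_topology X d) {x \<in> X. d x c < \<epsilon>}"
    unfolding lower_ball_topology_def using assms(2)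
    by (intro topology_generated_by_Basis) auto
  then have "openin Q {q \<in> topspace Q. f q \<in> {x \<in> X. d x c < \<epsilon>}}"
    by (rule openin_continuous_map_preimage[OF assms(1)])
  moreover have "{q \<in> topspace Q. f q \<in> {x \<in> X. d x c < \<epsilon>}} = {q \<in> topspace Q. d (f q) c < \<epsilon>}"
    using continuous_map_funspace[OF assms(1)] by fastforce
  ultimately show ?thesis by simp
qed auto

lemma openin_preimage_upper_ball:
  assumes "continuous_map Q (upper_ball_topology X d) g" "c \<in> X"
  shows "openin Q {q \<in> topspace Q. d c (g q) < \<epsilon>}"
proof (cases "\<epsilon> > 0")
  case True
  then have "openin (upper_ball_topology X d) {x \<in> X. d c x < \<epsilon>}"
    unfolding upper_ball_topology_def using assms(2)
    by (intro topology_generated_by_Basis) auto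
  then have "openin Q {q \<in> topspace Q. g q \<in> {x \<in> X. d c x < \<epsilon>}}"
    by (rule openin_continuous_map_preimage[OF assms(1)])
  moreover have "{q \<in> topspace Q. g q \<in> {x \<in> X. d c x < \<epsilon>}} = {q \<in> topspace Q. d c (g q) < \<epsilon>}"
    using continuous_map_funspace[OF assms(1)] by fastforce
  ultimately show ?thesis by simp
qed auto

text \<open>
  The neighbourhood is cut out by two late indices, \<open>\<delta>\<close> after \<open>\<gamma>\<close>. On it the path from \<open>f q\<close> to
  \<open>g \<gamma> p\<close> to \<open>g \<delta> q\<close> costs less than \<open>a + \<epsilon>\<close>, and the step from \<open>g \<delta> q\<close> to any later \<open>g i q\<close> costs
  the second \<open>\<epsilon>\<close>.
\<close>

lemma eventually_close_near_point:
  assumes dist: "is_distance X d" and net: "is_net I R"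
    and f: "continuous_map Q (lower_ball_topology X d) f"
    and g: "\<And>i. i \<in> I \<Longrightarrow> continuous_map Q (upper_ball_topology X d) (g i)"
    and cauchy: "\<forall>\<^sub>F i in net_filter I R.
      \<forall>j\<in>net_tail I R i. \<forall>q\<in>topspace Q. d (g i q) (g j q) < \<epsilon>"
    and p: "p \<in> topspace Q"
    and small: "\<forall>\<^sub>F i in net_filter I R. d (f p) (g i p) < a"
  shows "\<exists>U. openin Q U \<and> p \<in> U \<and>
    (\<forall>\<^sub>F i in net_filter I R. \<forall>q\<in>U. d (f q) (g i q) \<le> a + \<epsilon> + \<epsilon>)"
proof -
  note nontriv = net_filter_neq_bot[OF net]
  have fX: "f q \<in> X" if "q \<in> topspace Q" for q
    using continuous_map_funspace[OF f] that by auto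
  have gX: "g i q \<in> X" if "i \<in> I" "q \<in> topspace Q" for i q
    using continuous_map_funspace[OF g] that by fastforce
  have triangle: "d x y \<le> d x z + d z y" if "x \<in> X" "y \<in> X" "z \<in> X" for x y z
    using dist that by (auto simp: is_distance_def)
  have "\<exists>\<gamma>. \<gamma> \<in> I \<and> d (f p) (g \<gamma> p) < a \<and>
      (\<forall>j\<in>net_tail I R \<gamma>. \<forall>q\<in>topspace Q. d (g \<gamma> q) (g j q) < \<epsilon>)"
    by (intro eventually_happens'[OF nontriv] eventually_conj eventually_mem_net net cauchy small)
  then obtain \<gamma> where \<gamma>: "\<gamma> \<in> I" "d (f p) (g \<gamma> p) < a"
      "\<forall>j\<in>net_tail I R \<gamma>. \<forall>q\<in>topspace Q. d (g \<gamma> q) (g j q) < \<epsilon>"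
    by blast
  have "\<exists>\<delta>. \<delta> \<in> net_tail I R \<gamma> \<and>
      (\<forall>j\<in>net_tail I R \<delta>. \<forall>q\<in>topspace Q. d (g \<delta> q) (g j q) < \<epsilon>)"
    by (intro eventually_happens'[OF nontriv] eventually_conj eventually_mem_net_tail net \<gamma>(1) cauchy)
  then obtain \<delta> where \<delta>: "\<delta> \<in> net_tail I R \<gamma>"
      "\<forall>j\<in>net_tail I R \<delta>. \<forall>q\<in>topspace Q. d (g \<delta> q) (g j q) < \<epsilon>"
    by blast
  then have \<delta>I: "\<delta> \<in> I" by (simp add: net_tail_def)
  define U where "U = {q \<in> topspace Q. d (f q) (g \<gamma> p) < a} \<inter> {q \<in> topspace Q. d (g \<gamma> p) (g \<delta> q) < \<epsilon>}"
  have "openin Q U"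
    unfolding U_def using p \<gamma>(1) \<delta>I
    by (intro openin_Int openin_preimage_lower_ball[OF f] openin_preimage_upper_ball[OF g] gX)
  have "p \<in> U"
    using p \<gamma> \<delta>(1) by (auto simp: U_def)
  have bound: "d (f q) (g i q) \<le> a + \<epsilon> + \<epsilon>" if q: "q \<in> U" and i: "i \<in> net_tail I R \<delta>" for q i
  proof -
    have qQ: "q \<in> topspace Q" and near: "d (f q) (g \<gamma> p) < a" "d (g \<gamma> p) (g \<delta> q) < \<epsilon>"
      using q by (auto simp: U_def)
    have iI: "i \<in> I" using i by (simp add: net_tail_def)
    have "d (f q) (g i q) \<le> d (f q) (g \<delta> q) + d (g \<delta> q) (g i q)"
      by (intro triangle fX gX qQ iI \<delta>I)
    also have "\<dots> \<le> (d (f q) (g \<gamma> p) + d (g \<gamma> p) (g \<delta> q)) + d (g \<delta> q) (g i q)"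
      by (intro add_right_mono triangle fX gX qQ p \<gamma>(1) \<delta>I)
    also have "\<dots> \<le> a + \<epsilon> + \<epsilon>"
      using near \<delta>(2) i qQ by (intro add_mono less_imp_le) auto
    finally show ?thesis .
  qed
  have "\<forall>\<^sub>F i in net_filter I R. \<forall>q\<in>U. d (f q) (g i q) \<le> a + \<epsilon> + \<epsilon>"
    using eventually_mem_net_tail[OF net \<delta>I] by (rule eventually_mono) (use bound in blast)
  with \<open>openin Q U\<close> \<open>p \<in> U\<close> show ?thesis by blast
qed

theorem theorem1:
  fixes X :: "'a set" and d :: "'a \<Rightarrow> 'a \<Rightarrow> ennreal"
    and Q :: "'q topology" and f :: "'q \<Rightarrow> 'a"
    and \<Lambda> :: "'i set" and prec :: "'i \<Rightarrow> 'i \<Rightarrow> bool" and g :: "'i \<Rightarrow> 'q \<Rightarrow> 'a"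
  assumes "is_distance X d"
    and "compact_space Q"
    and "continuous_map Q (lower_ball_topology X d) f"
    and "is_net \<Lambda> prec"
    and "\<And>i. i \<in> \<Lambda> \<Longrightarrow> continuous_map Q (upper_ball_topology X d) (g i)"
    and "cauchy_net \<Lambda> prec (sup_dist (topspace Q) d) g"
  shows "net_convergent \<Lambda> prec (\<lambda>i. SUP p\<in>topspace Q. d (f p) (g i p)) \<and>
    (\<forall>p\<in>topspace Q. net_convergent \<Lambda> prec (\<lambda>i. d (f p) (g i p))) \<and>
    net_lim \<Lambda> prec (\<lambda>i. SUP p\<in>topspace Q. d (f p) (g i p)) =
      (SUP p\<in>topspace Q. net_lim \<Lambda> prec (\<lambda>i. d (f p) (g i p)))"
proof -
  note net = \<open>is_net \<Lambda> prec\<close>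
  let ?F = "net_filter \<Lambda> prec"
  let ?r = "\<lambda>p i. d (f p) (g i p)"
  let ?s = "\<lambda>i. SUP p\<in>topspace Q. ?r p i"
  have fX: "f q \<in> X" if "q \<in> topspace Q" for q
    using continuous_map_funspace[OF assms(3)] that by auto
  have gX: "g i q \<in> X" if "i \<in> \<Lambda>" "q \<in> topspace Q" for i q
    using continuous_map_funspace[OF assms(5)] that by fastforce
  have cauchy: "\<forall>\<^sub>F i in ?F. \<forall>j\<in>net_tail \<Lambda> prec i. \<forall>q\<in>topspace Q. d (g i q) (g j q) < \<epsilon>"
    if "0 < \<epsilon>" for \<epsilon>
    using cauchy_net_eventually_less[OF net assms(6) that]
    by (rule eventually_mono) (auto simp: sup_dist_def dest: SUP_lessD)
  have decr: "\<forall>\<^sub>F i in ?F. \<forall>j\<in>net_tail \<Lambda> prec i. \<forall>q\<in>topspace Q. ?r q j \<le> ?r q i + \<epsilon>"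
    if "0 < \<epsilon>" for \<epsilon>
    using eventually_conj[OF eventually_mem_net[OF net] cauchy[OF that]]
  proof (rule eventually_mono, intro ballI)
    fix i j q
    assume i: "i \<in> \<Lambda> \<and> (\<forall>j\<in>net_tail \<Lambda> prec i. \<forall>q\<in>topspace Q. d (g i q) (g j q) < \<epsilon>)"
      and j: "j \<in> net_tail \<Lambda> prec i" and q: "q \<in> topspace Q"
    have "?r q j \<le> ?r q i + d (g i q) (g j q)"
      using assms(1) fX[OF q] gX[OF _ q] i j by (simp add: is_distance_def net_tail_def)
    also have "\<dots> \<le> ?r q i + \<epsilon>"
      using i j q by (intro add_left_mono less_imp_le) blast
    finally show "?r q j \<le> ?r q i + \<epsilon>" .
  qed
  have conv_r: "net_convergent \<Lambda> prec (?r p)" if "p \<in> topspace Q" for p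
    using net
  proof (rule net_convergent_if_almost_decreasing)
    fix \<epsilon> :: ennreal assume "0 < \<epsilon>"
    from decr[OF this] show "\<forall>\<^sub>F i in ?F. \<forall>j\<in>net_tail \<Lambda> prec i. ?r p j \<le> ?r p i + \<epsilon>"
      by (rule eventually_mono) (use that in blast)
  qed
  have conv_s: "net_convergent \<Lambda> prec ?s"
    using net
  proof (rule net_convergent_if_almost_decreasing)
    fix \<epsilon> :: ennreal assume "0 < \<epsilon>"
    from decr[OF this] show "\<forall>\<^sub>F i in ?F. \<forall>j\<in>net_tail \<Lambda> prec i. ?s j \<le> ?s i + \<epsilon>"
    proof (rule eventually_mono, intro ballI SUP_least)
      fix i j q
      assume i: "\<forall>j\<in>net_tail \<Lambda> prec i. \<forall>q\<in>topspace Q. ?r q j \<le> ?r q i + \<epsilon>"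
        and j: "j \<in> net_tail \<Lambda> prec i" and q: "q \<in> topspace Q"
      have "?r q j \<le> ?r q i + \<epsilon>" using i j q by blast
      also have "\<dots> \<le> ?s i + \<epsilon>"
        using q by (intro add_right_mono SUP_upper)
      finally show "?r q j \<le> ?s i + \<epsilon>" .
    qed
  qed
  have lim_r: "(?r p \<longlongrightarrow> net_lim \<Lambda> prec (?r p)) ?F" if "p \<in> topspace Q" for p
    using net_lim_iff_tendsto[OF net] conv_r[OF that] by blast
  have lim_s: "(?s \<longlongrightarrow> net_lim \<Lambda> prec ?s) ?F"
    using net_lim_iff_tendsto[OF net] conv_s by blast
  define S where "S = (SUP p\<in>topspace Q. net_lim \<Lambda> prec (?r p))"
  have "S \<le> net_lim \<Lambda> prec ?s"
    unfolding S_def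
  proof (rule SUP_least)
    fix p assume p: "p \<in> topspace Q"
    show "net_lim \<Lambda> prec (?r p) \<le> net_lim \<Lambda> prec ?s"
      using net_filter_neq_bot[OF net] lim_s lim_r[OF p]
      by (rule tendsto_le) (intro always_eventually allI SUP_upper p)
  qed
  moreover have "net_lim \<Lambda> prec ?s \<le> S"
  proof (rule ennreal_le_epsilon)
    fix e :: real assume fin: "S < top" and "0 < e"
    \<comment> \<open>one third to exceed \<open>S\<close> strictly at each point, two more for the spread around it\<close>
    define \<eta> where "\<eta> = ennreal (e / 3)"
    have \<eta>: "0 < \<eta>" "S + \<eta> + \<eta> + \<eta> = S + ennreal e"
      using \<open>0 < e\<close> by (auto simp: \<eta>_def add.assoc simp flip: ennreal_plus)
    have "S < S + \<eta>"
      using fin \<eta>(1) ennreal_add_left_cancel_less[of S 0 \<eta>] by auto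
    have "\<forall>\<^sub>F i in ?F. \<forall>q\<in>topspace Q. ?r q i \<le> S + \<eta> + \<eta> + \<eta>"
      using assms(2)
    proof (rule compact_space_eventually_ball)
      fix p assume p: "p \<in> topspace Q"
      have "net_lim \<Lambda> prec (?r p) < S + \<eta>"
        using SUP_upper[OF p, of "\<lambda>p. net_lim \<Lambda> prec (?r p)"] \<open>S < S + \<eta>\<close>
        unfolding S_def[symmetric] by (rule le_less_trans)
      with lim_r[OF p] have "\<forall>\<^sub>F i in ?F. ?r p i < S + \<eta>"
        by (rule order_tendstoD)
      with assms(1) net assms(3,5) cauchy[OF \<eta>(1)] p
      show "\<exists>U. openin Q U \<and> p \<in> U \<and> (\<forall>\<^sub>F i in ?F. \<forall>q\<in>U. ?r q i \<le> S + \<eta> + \<eta> + \<eta>)"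
        by (rule eventually_close_near_point)
    qed
    then have "\<forall>\<^sub>F i in ?F. ?s i \<le> S + ennreal e"
      unfolding \<eta>(2) by (rule eventually_mono) (simp add: SUP_le_iff)
    with lim_s show "net_lim \<Lambda> prec ?s \<le> S + ennreal e"
      using net_filter_neq_bot[OF net] by (rule tendsto_upperbound)
  qed
  ultimately have "net_lim \<Lambda> prec ?s = S" by (rule antisym[rotated])
  then show ?thesis using conv_r conv_s by (simp add: S_def)
qed

end
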